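(* $D_\infty$ is the smallest fixed point of the operator $\bigtriangleup$; that is, $\bigtriangleup(D_\infty)=D_\infty$, and $D_\infty\subset\mathcal F$ for every family $\mathcal F$ of non-empty graphs with $\bigtriangleup(\mathcal F)=\mathcal F$.
   Context: All graphs are finite, undirected, without loops or multiple edges, with at least one vertex, and families of graphs are considered up to isomorphism (closed under isomorphism). For a graph $X$ and a vertex $x$, $N_X(x)$ is the set of neighbours of $x$, identified with the subgraph of $X$ it induces, $N_X[x]=N_X(x)\cup\{x\}$, and $X-x$ is the subgraph induced by $V(X)\setminus\{x\}$. A graph $X$ is a cone if it has a vertex $x$ with $N_X[x]=V(X)$; the one-vertex graph $pt$ is a cone. Let $D_{-1}$ be the class of cones. Inductively, for an integer $k\ge 0$: a vertex $x$ of $X$ is $k$-dismantlable if $N_X(x)$ is non-empty and the graph $N_X(x)$ belongs to $D_{k-1}$; a graph is $k$-dismantlable if it can be reduced to a single vertex by successively deleting vertices, each being $k$-dismantlable in the current graph; $D_k$ is the class of $k$-dismantlable graphs. $D_\infty=\bigcup_{k\ge 0}D_k$. For a family $\mathcal R$ of non-empty graphs, $\bigtriangleup(\mathcal R)$ is the smallest family of graphs which contains the one-vertex graph $pt$ and satisfies: for every graph $X$ and vertex $x$ of $X$, if $X-x\in\bigtriangleup(\mathcal R)$ and $N_X(x)\in\mathcal R$, then $X\in\bigtriangleup(\mathcal R)$. *)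

theory Defs
  imports "Graph_Theory.Graph_Theory" "HOL-Library.Infinite_Typeclass"
begin

text \<open>
  Finite simple undirected graphs are rendered by \<^locale>\<open>pair_graph\<close> (finite, loop-free, symmetric
  set of arcs, each undirected edge being a pair of opposite arcs). Vertices are drawn from a fixed
  type; if that type is infinite, every finite graph has an isomorphic copy on it, so that families
  of graphs up to isomorphism are the same as isomorphism-closed sets of graphs on this type.
\<close>

definition graphs :: "'a pair_pre_digraph set" where
  "graphs = {X. pair_graph X \<and> pverts X \<noteq> {}}"

definition graph_iso :: "'a pair_pre_digraph \<Rightarrow> 'a pair_pre_digraph \<Rightarrow> bool" where
  "graph_iso X Y \<longleftrightarrow> digraph_iso (with_proj X) (with_proj Y)"

definition graph_family :: "'a pair_pre_digraph set \<Rightarrow> bool" where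
  "graph_family F \<longleftrightarrow> F \<subseteq> graphs \<and> (\<forall>X\<in>F. \<forall>Y\<in>graphs. graph_iso X Y \<longrightarrow> Y \<in> F)"

definition induced :: "'a pair_pre_digraph \<Rightarrow> 'a set \<Rightarrow> 'a pair_pre_digraph" where
  "induced X S = \<lparr> pverts = S, parcs = {e \<in> parcs X. fst e \<in> S \<and> snd e \<in> S} \<rparr>"

text \<open>The library's induced subgraph does not return a \<^type>\<open>pair_pre_digraph_ext\<close>; they agree:\<close>

lemma with_proj_induced: "with_proj (induced X S) = with_proj X \<restriction> S"
  by (simp add: with_proj_def induced_def induce_subgraph_def)

definition nbrs :: "'a pair_pre_digraph \<Rightarrow> 'a \<Rightarrow> 'a set" where
  "nbrs X x = {y \<in> pverts X. (x, y) \<in> parcs X}"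

definition nbhd :: "'a pair_pre_digraph \<Rightarrow> 'a \<Rightarrow> 'a pair_pre_digraph" where
  "nbhd X x = induced X (nbrs X x)"

definition remove_vertex :: "'a pair_pre_digraph \<Rightarrow> 'a \<Rightarrow> 'a pair_pre_digraph" where
  "remove_vertex X x = induced X (pverts X - {x})"

definition cones :: "'a pair_pre_digraph set" where
  "cones = {X \<in> graphs. \<exists>x\<in>pverts X. insert x (nbrs X x) = pverts X}"

text \<open>
  In the next two definitions, \<open>C\<close> is the class to which the neighbourhoods of the deleted
  vertices have to belong; it is instantiated with the cones and then with the classes \<open>D k\<close>.
\<close>

definition dismantlable_vertex :: "'a pair_pre_digraph set \<Rightarrow> 'a pair_pre_digraph \<Rightarrow> 'a \<Rightarrow> bool" where
  "dismantlable_vertex C X x \<longleftrightarrow> x \<in> pverts X \<and> nbrs X x \<noteq> {} \<and> nbhd X x \<in> C"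

definition deletion_step ::
    "'a pair_pre_digraph set \<Rightarrow> 'a pair_pre_digraph \<Rightarrow> 'a pair_pre_digraph \<Rightarrow> bool" where
  "deletion_step C X Y \<longleftrightarrow> (\<exists>x. dismantlable_vertex C X x \<and> Y = remove_vertex X x)"

definition dismantlable :: "'a pair_pre_digraph set \<Rightarrow> 'a pair_pre_digraph set" where
  "dismantlable C = {X \<in> graphs. \<exists>Y. (deletion_step C)\<^sup>*\<^sup>* X Y \<and> card (pverts Y) = 1}"

primrec D :: "nat \<Rightarrow> 'a pair_pre_digraph set" where
  "D 0 = dismantlable cones"
| "D (Suc k) = dismantlable (D k)"

definition D_inf :: "'a pair_pre_digraph set" where
  "D_inf = (\<Union>k. D k)"

text \<open>
  The smallest family means the smallest isomorphism-closed one, hence the rule \<open>iso\<close>.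
\<close>

inductive_set triangle_op :: "'a pair_pre_digraph set \<Rightarrow> 'a pair_pre_digraph set"
  for R :: "'a pair_pre_digraph set" where
  pt: "X \<in> graphs \<Longrightarrow> card (pverts X) = 1 \<Longrightarrow> X \<in> triangle_op R"
| iso: "X \<in> triangle_op R \<Longrightarrow> Y \<in> graphs \<Longrightarrow> graph_iso X Y \<Longrightarrow> Y \<in> triangle_op R"
| extend: "X \<in> graphs \<Longrightarrow> x \<in> pverts X \<Longrightarrow> remove_vertex X x \<in> triangle_op R \<Longrightarrow> nbhd X x \<in> R
    \<Longrightarrow> X \<in> triangle_op R"

end

theory Submission
  imports Defs
begin

text \<open>
  The classes \<^term>\<open>D k\<close> are the iterates of the operator \<^const>\<open>triangle_op\<close> on the class of
  cones: reading a sequence of deletions backwards, from the last vertex to the whole graph, turns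
  it into a sequence of extensions, so that \<^term>\<open>dismantlable C = triangle_op C\<close> for every family
  \<^term>\<open>C\<close> of non-empty graphs (\<open>dismantlable_eq_triangle_op\<close>). The only difference between the two
  is that closure under isomorphism is a rule for \<^const>\<open>triangle_op\<close>, whereas for
  \<^const>\<open>dismantlable\<close> it has to be proved, by transporting deletions along an isomorphism
  (\<open>graph_family_dismantlable\<close>).

  The combinatorial ingredient is a property of cones (\<open>cones_induct\<close>). If \<open>a\<close> is the apex of a cone
  \<open>X\<close> and \<open>x\<close> is any other vertex, then \<open>X - x\<close> and \<open>N(x)\<close> are again cones with apex \<open>a\<close>, and both
  have fewer vertices than \<open>X\<close>. So cones can be built from one vertex by extensions along cones, and
  induction gives two inclusions. The cones are contained in \<^term>\<open>triangle_op cones\<close>, which by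
  monotonicity makes the sequence of the \<^term>\<open>D k\<close> increasing; and they are contained in every
  \<^term>\<open>F\<close> with \<^term>\<open>triangle_op F \<subseteq> F\<close>.

  The theorem then follows as in Kleene's fixed point theorem. Continuity enters in
  \<^term>\<open>triangle_op D_inf \<subseteq> D_inf\<close>: an extension of a graph involves only two members of
  \<^term>\<open>D_inf\<close>, namely \<open>X - x\<close> and \<open>N(x)\<close>, and in an increasing union these lie in a common
  \<^term>\<open>D k\<close>. Minimality holds because a fixed point contains the cones and, together with a class
  \<^term>\<open>C\<close>, also \<^term>\<open>triangle_op C\<close>; so it contains every \<^term>\<open>D k\<close>.
\<close>

section \<open>Graphs and their isomorphic copies\<close>

lemma graphs_iff:
  "X \<in> graphs \<longleftrightarrow> finite (pverts X) \<and> pverts X \<noteq> {} \<and> parcs X \<subseteq> pverts X \<times> pverts X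
    \<and> sym (parcs X) \<and> irrefl (parcs X)"
proof
  assume "X \<in> graphs"
  then have ne: "pverts X \<noteq> {}" and "pair_graph X" by (auto simp: graphs_def)
  then interpret pair_graph X by simp
  have "irrefl (parcs X)" using pair_no_loops by (fastforce simp: irrefl_def)
  then show "finite (pverts X) \<and> pverts X \<noteq> {} \<and> parcs X \<subseteq> pverts X \<times> pverts X
      \<and> sym (parcs X) \<and> irrefl (parcs X)"
    using ne pair_finite_verts pair_sym_arcs wellformed' by (auto simp: symmetric_def)
next
  assume *: "finite (pverts X) \<and> pverts X \<noteq> {} \<and> parcs X \<subseteq> pverts X \<times> pverts X
    \<and> sym (parcs X) \<and> irrefl (parcs X)"
  then have "finite (parcs X)" by (meson finite_SigmaI finite_subset)
  then have "pair_graph X"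
    using * by unfold_locales (auto simp: symmetric_def irrefl_def)
  then show "X \<in> graphs" using * by (simp add: graphs_def)
qed

lemma induced_graphs: "X \<in> graphs \<Longrightarrow> S \<subseteq> pverts X \<Longrightarrow> S \<noteq> {} \<Longrightarrow> induced X S \<in> graphs"
  unfolding graphs_iff induced_def
  by (auto simp: sym_def irrefl_def intro: finite_subset)

lemma pverts_induced [simp]: "pverts (induced X S) = S"
  by (simp add: induced_def)

lemma nbrs_subset: "nbrs X x \<subseteq> pverts X"
  by (auto simp: nbrs_def)

lemma self_notin_nbrs: "X \<in> graphs \<Longrightarrow> x \<notin> nbrs X x"
  by (auto simp: graphs_iff nbrs_def irrefl_def)

definition map_graph :: "('a \<Rightarrow> 'a) \<Rightarrow> 'a pair_pre_digraph \<Rightarrow> 'a pair_pre_digraph" where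
  "map_graph f X = \<lparr>pverts = f ` pverts X, parcs = map_prod f f ` parcs X\<rparr>"

lemma pverts_map_graph [simp]: "pverts (map_graph f X) = f ` pverts X"
  by (simp add: map_graph_def)

text \<open>
  Isomorphisms of digraphs act on arcs by a map of their own. As arcs are pairs here, their ends
  determine them, so this map is forced by the action on vertices.
\<close>

lemma graph_iso_imp_map_graph:
  assumes "graph_iso X Y"
  obtains f where "inj_on f (pverts X)" and "Y = map_graph f X"
proof -
  interpret pair_pre_digraph X .
  from assms obtain h where h: "digraph_isomorphism h" and Y: "with_proj Y = app_iso h (with_proj X)"
    unfolding graph_iso_def digraph_iso_def by blast
  have V: "pverts Y = iso_verts h ` pverts X" and A: "parcs Y = iso_arcs h ` parcs X"
    and "iso_tail h = fst" and "iso_head h = snd"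
    using Y by (simp_all add: with_proj_def app_iso_def)
  then have "iso_arcs h e = map_prod (iso_verts h) (iso_verts h) e" if "e \<in> parcs X" for e
    using h that by (auto simp: digraph_isomorphism_def prod_eq_iff)
  then have "parcs Y = map_prod (iso_verts h) (iso_verts h) ` parcs X"
    using A by (metis (no_types, lifting) image_cong)
  then have "Y = map_graph (iso_verts h) X"
    using V by (simp add: map_graph_def)
  moreover have "inj_on (iso_verts h) (pverts X)"
    using h by (simp add: digraph_isomorphism_def)
  ultimately show thesis using that by blast
qed

lemma map_graph_in_graphs:
  assumes "X \<in> graphs" and "inj_on f (pverts X)"
  shows "map_graph f X \<in> graphs"
proof -
  have "irrefl (map_prod f f ` parcs X)"
    using assms by (fastforce simp: irrefl_def graphs_iff dest: inj_onD)
  moreover have "sym (map_prod f f ` parcs X)"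
    using assms by (force simp: graphs_iff sym_def)
  ultimately show ?thesis
    using assms by (auto simp: graphs_iff map_graph_def)
qed

lemma graph_iso_map_graph:
  assumes "X \<in> graphs" and inj: "inj_on f (pverts X)"
  shows "graph_iso X (map_graph f X)"
proof -
  interpret pair_graph X using assms by (simp add: graphs_def)
  have sub: "parcs X \<subseteq> pverts X \<times> pverts X" using assms by (simp add: graphs_iff)
  let ?h = "\<lparr>iso_verts = f, iso_arcs = map_prod f f, iso_head = snd, iso_tail = fst\<rparr>"
  have "inj_on (map_prod f f) (parcs X)"
    using map_prod_inj_on[OF inj inj] sub by (rule inj_on_subset)
  then have "digraph_isomorphism ?h"
    using inj wf_digraph by (simp add: digraph_isomorphism_def)
  moreover have "with_proj (map_graph f X) = app_iso ?h (with_proj X)"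
    by (simp add: with_proj_def app_iso_def map_graph_def)
  ultimately show ?thesis unfolding graph_iso_def digraph_iso_def by blast
qed

lemma Collect_mem_image: "{y \<in> f ` A. P y} = f ` {x \<in> A. P (f x)}"
  by blast

lemma map_graph_induced:
  assumes "X \<in> graphs" and "inj_on f (pverts X)" and "S \<subseteq> pverts X"
  shows "induced (map_graph f X) (f ` S) = map_graph f (induced X S)"
proof -
  have mem: "f u \<in> f ` S \<longleftrightarrow> u \<in> S" if "u \<in> pverts X" for u
    using assms that by (meson inj_on_image_mem_iff)
  have arc: "fst e \<in> pverts X" "snd e \<in> pverts X" if "e \<in> parcs X" for e
    using assms that by (auto simp: graphs_iff)
  have "{e \<in> map_prod f f ` parcs X. fst e \<in> f ` S \<and> snd e \<in> f ` S}
      = map_prod f f ` {e \<in> parcs X. fst (map_prod f f e) \<in> f ` S \<and> snd (map_prod f f e) \<in> f ` S}"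
    by (rule Collect_mem_image)
  also have "\<dots> = map_prod f f ` {e \<in> parcs X. fst e \<in> S \<and> snd e \<in> S}"
    by (simp only: fst_map_prod snd_map_prod arc mem cong: conj_cong)
  finally show ?thesis by (simp add: induced_def map_graph_def)
qed

lemma nbrs_map_graph:
  assumes "X \<in> graphs" and "inj_on f (pverts X)" and "x \<in> pverts X"
  shows "nbrs (map_graph f X) (f x) = f ` nbrs X x"
proof -
  have "parcs X \<subseteq> pverts X \<times> pverts X" using assms by (simp add: graphs_iff)
  then have arc: "(f x, f y) \<in> map_prod f f ` parcs X \<longleftrightarrow> (x, y) \<in> parcs X" if "y \<in> pverts X" for y
    using assms that by (auto dest: inj_onD)
  have "nbrs (map_graph f X) (f x) = f ` {y \<in> pverts X. (f x, f y) \<in> map_prod f f ` parcs X}"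
    by (simp only: nbrs_def map_graph_def pair_pre_digraph.simps Collect_mem_image)
  also have "\<dots> = f ` nbrs X x"
    by (simp only: nbrs_def arc cong: conj_cong)
  finally show ?thesis .
qed

lemma nbhd_map_graph:
  assumes "X \<in> graphs" and "inj_on f (pverts X)" and "x \<in> pverts X"
  shows "nbhd (map_graph f X) (f x) = map_graph f (nbhd X x)"
  using assms by (simp add: nbhd_def nbrs_map_graph map_graph_induced nbrs_subset)

lemma remove_vertex_map_graph:
  assumes "X \<in> graphs" and "inj_on f (pverts X)" and "x \<in> pverts X"
  shows "remove_vertex (map_graph f X) (f x) = map_graph f (remove_vertex X x)"
proof -
  have "f ` pverts X - {f x} = f ` (pverts X - {x})"
    using inj_on_image_set_diff[OF assms(2), of "pverts X" "{x}"] assms(3) by auto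
  then show ?thesis
    using assms by (simp add: remove_vertex_def map_graph_induced)
qed

lemma graph_familyI:
  assumes "C \<subseteq> graphs"
    and "\<And>X f. X \<in> C \<Longrightarrow> inj_on f (pverts X) \<Longrightarrow> map_graph f X \<in> C"
  shows "graph_family C"
  unfolding graph_family_def using assms by (metis graph_iso_imp_map_graph)

lemma graph_family_map_graph:
  assumes "graph_family C" and "X \<in> C" and "inj_on f (pverts X)"
  shows "map_graph f X \<in> C"
  using assms graph_iso_map_graph map_graph_in_graphs unfolding graph_family_def by blast

section \<open>Dismantlable graphs as iterated extensions\<close>

lemma dismantlable_pt: "X \<in> graphs \<Longrightarrow> card (pverts X) = 1 \<Longrightarrow> X \<in> dismantlable C"
  by (auto simp: dismantlable_def)

lemma dismantlable_extend:
  assumes "C \<subseteq> graphs" and "X \<in> graphs" and "x \<in> pverts X"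
    and "remove_vertex X x \<in> dismantlable C" and "nbhd X x \<in> C"
  shows "X \<in> dismantlable C"
proof -
  have "nbrs X x \<noteq> {}"
    using assms by (auto simp: nbhd_def graphs_iff)
  then have "deletion_step C X (remove_vertex X x)"
    using assms by (auto simp: deletion_step_def dismantlable_vertex_def)
  then show ?thesis
    using assms by (auto simp: dismantlable_def intro: converse_rtranclp_into_rtranclp)
qed

text \<open>
  Reading a deletion sequence backwards: the graph grows from its last vertex by extensions.
\<close>

lemma dismantlable_induct [consumes 1, case_names pt extend]:
  assumes "X \<in> dismantlable C"
    and pt: "\<And>X. X \<in> graphs \<Longrightarrow> card (pverts X) = 1 \<Longrightarrow> P X"
    and extend: "\<And>X x. X \<in> graphs \<Longrightarrow> x \<in> pverts X \<Longrightarrow> remove_vertex X x \<in> dismantlable C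
      \<Longrightarrow> P (remove_vertex X x) \<Longrightarrow> nbhd X x \<in> C \<Longrightarrow> P X"
  shows "P X"
proof -
  from assms(1) obtain Y where "(deletion_step C)\<^sup>*\<^sup>* X Y" and Y: "card (pverts Y) = 1"
    and "X \<in> graphs" by (auto simp: dismantlable_def)
  then show ?thesis
  proof (induction rule: converse_rtranclp_induct)
    case base
    then show ?case by (simp add: pt)
  next
    case (step X Z)
    then obtain x where x: "x \<in> pverts X" "nbrs X x \<noteq> {}" "nbhd X x \<in> C"
      and Z: "Z = remove_vertex X x"
      by (auto simp: deletion_step_def dismantlable_vertex_def)
    \<comment> \<open>A neighbour of \<open>x\<close> survives, so that the smaller graph is not empty.\<close>
    have "pverts X - {x} \<noteq> {}"
      using x self_notin_nbrs[OF \<open>X \<in> graphs\<close>] nbrs_subset[of X x] by blast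
    then have "Z \<in> graphs"
      using \<open>X \<in> graphs\<close> by (simp add: Z remove_vertex_def induced_graphs)
    moreover from this have "Z \<in> dismantlable C"
      using step.hyps Y by (auto simp: dismantlable_def)
    ultimately show ?case
      using extend[of X x] step x Z by simp
  qed
qed

text \<open>
  An isomorphism restricts to \<open>X - x\<close> and to \<open>N(x)\<close>, so it carries each deletion to a deletion.
\<close>

lemma graph_family_dismantlable:
  assumes C: "graph_family C"
  shows "graph_family (dismantlable C)"
proof (rule graph_familyI)
  show "dismantlable C \<subseteq> graphs" by (auto simp: dismantlable_def)
next
  fix X :: "'a pair_pre_digraph" and f :: "'a \<Rightarrow> 'a"
  assume "X \<in> dismantlable C" and "inj_on f (pverts X)"
  then show "map_graph f X \<in> dismantlable C"
  proof (induction rule: dismantlable_induct)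
    case (pt X)
    then show ?case by (simp add: dismantlable_pt map_graph_in_graphs card_image)
  next
    case (extend X x)
    have "map_graph f (nbhd X x) \<in> C"
    proof (rule graph_family_map_graph[OF C extend.hyps(4)])
      show "inj_on f (pverts (nbhd X x))"
        using inj_on_subset[OF extend.prems nbrs_subset[of X x]] by (simp add: nbhd_def)
    qed
    moreover have "map_graph f (remove_vertex X x) \<in> dismantlable C"
      using inj_on_subset[OF extend.prems Diff_subset, of "{x}"]
      by (intro extend.IH) (simp add: remove_vertex_def)
    moreover have "C \<subseteq> graphs" using C by (simp add: graph_family_def)
    ultimately show ?case
      using dismantlable_extend[of C "map_graph f X" "f x"]
        map_graph_in_graphs[OF extend.hyps(1) extend.prems]
        nbhd_map_graph[OF extend.hyps(1) extend.prems extend.hyps(2)]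
        remove_vertex_map_graph[OF extend.hyps(1) extend.prems extend.hyps(2)] extend.hyps(2)
      by simp
  qed
qed

lemma dismantlable_eq_triangle_op:
  assumes C: "graph_family C"
  shows "dismantlable C = triangle_op C"
proof
  show "dismantlable C \<subseteq> triangle_op C"
  proof
    fix X assume "X \<in> dismantlable C"
    then show "X \<in> triangle_op C"
      by (induction rule: dismantlable_induct) (auto intro: triangle_op.pt triangle_op.extend)
  qed
next
  have "C \<subseteq> graphs" using C by (simp add: graph_family_def)
  show "triangle_op C \<subseteq> dismantlable C"
  proof
    fix X assume "X \<in> triangle_op C"
    then show "X \<in> dismantlable C"
    proof induction
      case (pt X)
      then show ?case by (rule dismantlable_pt)
    next
      case (iso X Y)
      then show ?case
        using graph_family_dismantlable[OF C] by (auto simp: graph_family_def)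
    next
      case (extend X x)
      then show ?case
        using dismantlable_extend[OF \<open>C \<subseteq> graphs\<close>] by blast
    qed
  qed
qed

lemma triangle_op_mono: "C \<subseteq> C' \<Longrightarrow> triangle_op C \<subseteq> triangle_op C'"
proof
  fix X assume "C \<subseteq> C'" and "X \<in> triangle_op C"
  from this(2) show "X \<in> triangle_op C'"
    by induction (use \<open>C \<subseteq> C'\<close> in \<open>auto intro: triangle_op.intros\<close>)
qed

section \<open>Cones\<close>

lemma graph_family_cones: "graph_family cones"
proof (rule graph_familyI)
  fix X :: "'a pair_pre_digraph" and f :: "'a \<Rightarrow> 'a"
  assume X: "X \<in> cones" and inj: "inj_on f (pverts X)"
  then obtain a where "X \<in> graphs" "a \<in> pverts X" "insert a (nbrs X a) = pverts X"
    by (auto simp: cones_def)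
  moreover from this have "insert (f a) (nbrs (map_graph f X) (f a)) = f ` pverts X"
    using inj by (metis image_insert nbrs_map_graph)
  ultimately show "map_graph f X \<in> cones"
    using inj by (auto simp: cones_def map_graph_in_graphs)
qed (auto simp: cones_def)

lemma induced_cone:
  assumes "X \<in> graphs" and "insert a (nbrs X a) = pverts X" and "a \<in> S" and "S \<subseteq> pverts X"
  shows "induced X S \<in> cones"
proof -
  have "insert a (nbrs (induced X S) a) = S"
    using assms by (auto simp: nbrs_def induced_def)
  then show ?thesis
    using assms induced_graphs[of X S] by (auto simp: cones_def)
qed

text \<open>
  Let \<open>x\<close> be a vertex other than the apex. It is adjacent to the apex, so the apex belongs both to
  \<open>X - x\<close> and to \<open>N(x)\<close>, which are therefore smaller cones.
\<close>

lemma cones_induct [consumes 1, case_names pt extend]: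
  assumes "X \<in> cones"
    and pt: "\<And>X. X \<in> graphs \<Longrightarrow> card (pverts X) = 1 \<Longrightarrow> P X"
    and extend: "\<And>X x. X \<in> graphs \<Longrightarrow> x \<in> pverts X \<Longrightarrow> remove_vertex X x \<in> cones
      \<Longrightarrow> P (remove_vertex X x) \<Longrightarrow> nbhd X x \<in> cones \<Longrightarrow> P (nbhd X x) \<Longrightarrow> P X"
  shows "P X"
  using assms(1)
proof (induction "card (pverts X)" arbitrary: X rule: less_induct)
  case less
  then obtain a where X: "X \<in> graphs" and a: "a \<in> pverts X" "insert a (nbrs X a) = pverts X"
    by (auto simp: cones_def)
  have fin: "finite (pverts X)" using X by (simp add: graphs_iff)
  show ?case
  proof (cases "pverts X = {a}")
    case True
    then show ?thesis using pt X by simp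
  next
    case False
    then obtain x where x: "x \<in> pverts X" "x \<noteq> a" using a by blast
    have "(a, x) \<in> parcs X" using a x by (auto simp: nbrs_def)
    then have ax: "a \<in> nbrs X x"
      using X a by (auto simp: nbrs_def graphs_iff dest: symD)
    have "nbhd X x \<in> cones"
      unfolding nbhd_def using X a ax nbrs_subset by (intro induced_cone[where a = a])
    moreover have "remove_vertex X x \<in> cones"
      unfolding remove_vertex_def using X a x by (intro induced_cone[where a = a]) auto
    moreover have "card (pverts (nbhd X x)) < card (pverts X)"
      unfolding nbhd_def
      using x fin nbrs_subset[of X x] self_notin_nbrs[OF X, of x] by (auto intro: psubset_card_mono)
    moreover have "card (pverts (remove_vertex X x)) < card (pverts X)"
      using card_Diff1_less[OF fin x(1)] by (simp only: remove_vertex_def pverts_induced)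
    ultimately show ?thesis
      using extend[OF X x(1)] less.hyps by blast
  qed
qed

lemma cones_subset_triangle_op_cones: "cones \<subseteq> triangle_op cones"
proof
  fix X :: "'a pair_pre_digraph"
  assume "X \<in> cones"
  then show "X \<in> triangle_op cones"
    by (induction rule: cones_induct) (auto intro: triangle_op.pt triangle_op.extend)
qed

text \<open>
  The induction carries membership in \<^term>\<open>triangle_op F\<close>: that is what an extension requires of
  \<open>X - x\<close>, and the assumption gives the membership of \<open>N(x)\<close> in \<^term>\<open>F\<close>.
\<close>

lemma cones_subset_triangle_op:
  fixes F :: "'a pair_pre_digraph set"
  assumes "triangle_op F \<subseteq> F"
  shows "cones \<subseteq> triangle_op F"
proof
  fix X :: "'a pair_pre_digraph"
  assume "X \<in> cones"
  then show "X \<in> triangle_op F"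
    by (induction rule: cones_induct) (use assms in \<open>auto intro: triangle_op.pt triangle_op.extend\<close>)
qed

section \<open>The smallest fixed point\<close>

lemma graph_family_D: "graph_family (D k)"
  by (induction k) (simp_all add: graph_family_cones graph_family_dismantlable)

lemma graph_family_D_inf: "graph_family D_inf"
  using graph_family_D unfolding D_inf_def graph_family_def by blast

lemma D_0_eq: "D 0 = triangle_op cones"
  by (simp add: dismantlable_eq_triangle_op graph_family_cones)

lemma D_Suc_eq: "D (Suc k) = triangle_op (D k)"
  by (simp add: dismantlable_eq_triangle_op graph_family_D)

lemma D_mono: "mono D"
proof (rule incseq_SucI)
  fix k
  show "D k \<subseteq> D (Suc k)"
  proof (induction k)
    case 0
    have "cones \<subseteq> D 0" using cones_subset_triangle_op_cones by (simp only: D_0_eq)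
    then have "triangle_op cones \<subseteq> triangle_op (D 0)" by (rule triangle_op_mono)
    then show ?case by (simp only: D_Suc_eq D_0_eq)
  next
    case (Suc k)
    then show ?case unfolding D_Suc_eq by (rule triangle_op_mono)
  qed
qed

lemma triangle_op_D_inf: "triangle_op D_inf = (D_inf :: 'a pair_pre_digraph set)"
proof
  show "triangle_op D_inf \<subseteq> (D_inf :: 'a pair_pre_digraph set)"
  proof
    fix X :: "'a pair_pre_digraph"
    assume "X \<in> triangle_op D_inf"
    then show "X \<in> D_inf"
    proof induction
      case (pt X)
      then have "X \<in> D 0" by (simp add: dismantlable_pt)
      then show ?case unfolding D_inf_def by blast
    next
      case (iso X Y)
      then show ?case using graph_family_D_inf by (auto simp: graph_family_def)
    next
      case (extend X x)
      then obtain i j where "remove_vertex X x \<in> D i" and "nbhd X x \<in> D j"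
        by (auto simp: D_inf_def)
      moreover have "D i \<subseteq> D (Suc (max i j))" and "D j \<subseteq> D (max i j)"
        by (rule monoD[OF D_mono], simp)+
      ultimately have "remove_vertex X x \<in> D (Suc (max i j))" and "nbhd X x \<in> D (max i j)"
        by blast+
      then have "X \<in> D (Suc (max i j))"
        using extend.hyps(1,2) unfolding D_Suc_eq by (simp only: triangle_op.extend)
      then show ?case unfolding D_inf_def by blast
    qed
  qed
next
  have "D k \<subseteq> triangle_op (D_inf :: 'a pair_pre_digraph set)" for k
  proof -
    have "D k \<subseteq> D (Suc k)" by (rule monoD[OF D_mono]) simp
    also have "\<dots> \<subseteq> triangle_op D_inf"
      unfolding D_Suc_eq by (rule triangle_op_mono) (auto simp: D_inf_def)
    finally show ?thesis .
  qed
  then show "D_inf \<subseteq> triangle_op (D_inf :: 'a pair_pre_digraph set)" by (auto simp: D_inf_def)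
qed

lemma D_inf_least:
  assumes F: "triangle_op F = F"
  shows "D_inf \<subseteq> F"
proof -
  have "D k \<subseteq> F" for k
  proof (induction k)
    case 0
    have "cones \<subseteq> F" using cones_subset_triangle_op[of F] F by simp
    then show ?case using triangle_op_mono[of cones F] by (simp only: D_0_eq F)
  next
    case (Suc k)
    then show ?case using triangle_op_mono[of "D k" F] by (simp only: D_Suc_eq F)
  qed
  then show ?thesis by (auto simp: D_inf_def)
qed

theorem proposition24:
  shows "graph_family (D_inf :: ('a::infinite) pair_pre_digraph set)
    \<and> triangle_op (D_inf :: 'a pair_pre_digraph set) = D_inf
    \<and> (\<forall>F :: 'a pair_pre_digraph set. graph_family F \<and> triangle_op F = F \<longrightarrow> D_inf \<subseteq> F)"
  using graph_family_D_inf triangle_op_D_inf D_inf_least by blast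

end
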